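(* Let $(X,\rho)$ be a complete locally compact $\mathbb R$-tree. Then the metric space $(\mathcal O_+^r(X),\operatorname{Hd})$ is isometric to $(X,\rho)$, and the topological space $\mathcal O_+(X)$ (with the topology generated by the base $\mathcal B$ described below) is homeomorphic to the metric compactification $\overline{X}_m$ of $X$.
   Context: An $\mathbb R$-tree is a geodesic metric space in which any two points are joined by a unique segment and $[xy]\subset[xz]\cup[zy]$ for all $x,y,z$. For a partial order $\tau$ on $X$ (written $x\,\tau\,y$), $(X,\rho,\tau)$ is an upper-semilinear metric $\vee$-semilattice if: any two points $x,y$ have a supremum $x\vee y$; $x\,\tau\, z\,\tau\, y$ implies $\rho(x,z)+\rho(z,y)=\rho(x,y)$; $\rho(x,y)=\rho(x,x\vee y)+\rho(x\vee y,y)$ for all $x,y$; and every upper cone $\{y: x\,\tau\, y\}$ is linearly ordered. $\mathcal O_+(X)$ is the set of all partial orders $\tau$ on $X$ for which this holds; $\mathcal O_+^r(X)\subset\mathcal O_+(X)$ is the subset of rooted orders, i.e. those having a greatest element (the root). For $y\in X$, $\preceq_{(y)}$ denotes the order in $\mathcal O_+(X)$ with root $y$, namely $s\preceq_{(y)} t$ iff $t\in[ys]$. Each order is regarded as a subset of $X\times X$, equipped with the sum metric $d_+((x_1,x_2),(y_1,y_2))=\rho(x_1,y_1)+\rho(x_2,y_2)$, and $\operatorname{Hd}(V,W)=\inf\{\varepsilon>0: V\subset\mathcal N_\varepsilon(W),\ W\subset\mathcal N_\varepsilon(V)\}$ is the Hausdorff distance with respect to $d_+$, where $\mathcal N_\varepsilon$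 is the open $\varepsilon$-neighbourhood. The topology on $\mathcal O_+(X)$ is the one generated by the base $\mathcal B$ consisting of all open subsets of the metric space $(\mathcal O_+^r(X),\operatorname{Hd})$ together with all sets $\mathcal U_{(x,y)}=\{\tau\in\mathcal O_+(X): x\,\tau\, y\}\setminus\{\preceq_{(y)}\}$ for $x\neq y$ in $X$. The metric compactification $\overline{X}_m$ is the closure of the image of $X$ under the embedding $x\mapsto d_x$, $d_x(y)=\rho(x,y)-\rho(o,x)$ ($o\in X$ a fixed point), into the quotient $C(X,\mathbb R)/\{\text{constants}\}$, where $C(X,\mathbb R)$ carries the compact-open topology. *)

theory Defs
  imports "HOL-Analysis.Analysis"
begin

definition is_segment :: "'a::metric_space \<Rightarrow> 'a \<Rightarrow> 'a set \<Rightarrow> bool" where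
  "is_segment x y S \<longleftrightarrow> (\<exists>\<gamma>::real \<Rightarrow> 'a. \<gamma> 0 = x \<and> \<gamma> (dist x y) = y \<and>
      (\<forall>s\<in>{0..dist x y}. \<forall>t\<in>{0..dist x y}. dist (\<gamma> s) (\<gamma> t) = \<bar>s - t\<bar>) \<and>
      S = \<gamma> ` {0..dist x y})"

definition seg :: "'a::metric_space \<Rightarrow> 'a \<Rightarrow> 'a set" where
  "seg x y = (THE S. is_segment x y S)"

definition R_tree :: "'a::metric_space itself \<Rightarrow> bool" where
  "R_tree _ \<longleftrightarrow> (\<forall>x y::'a. \<exists>!S. is_segment x y S) \<and>
     (\<forall>x y z::'a. seg x y \<subseteq> seg x z \<union> seg z y)"

definition is_sup :: "('a \<times> 'a) set \<Rightarrow> 'a \<Rightarrow> 'a \<Rightarrow> 'a \<Rightarrow> bool" where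
  "is_sup \<tau> x y s \<longleftrightarrow> (x, s) \<in> \<tau> \<and> (y, s) \<in> \<tau> \<and>
     (\<forall>u. (x, u) \<in> \<tau> \<and> (y, u) \<in> \<tau> \<longrightarrow> (s, u) \<in> \<tau>)"

definition join :: "('a \<times> 'a) set \<Rightarrow> 'a \<Rightarrow> 'a \<Rightarrow> 'a" where
  "join \<tau> x y = (THE s. is_sup \<tau> x y s)"

definition usms :: "('a::metric_space \<times> 'a) set \<Rightarrow> bool" where
  "usms \<tau> \<longleftrightarrow> partial_order_on UNIV \<tau> \<and>
     (\<forall>x y. \<exists>s. is_sup \<tau> x y s) \<and>
     (\<forall>x y z. (x, z) \<in> \<tau> \<and> (z, y) \<in> \<tau> \<longrightarrow> dist x z + dist z y = dist x y) \<and>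
     (\<forall>x y. dist x y = dist x (join \<tau> x y) + dist (join \<tau> x y) y) \<and>
     (\<forall>x y z. (x, y) \<in> \<tau> \<and> (x, z) \<in> \<tau> \<longrightarrow> (y, z) \<in> \<tau> \<or> (z, y) \<in> \<tau>)"

definition O_plus :: "('a::metric_space \<times> 'a) set set" where
  "O_plus = {\<tau>. usms \<tau>}"

definition O_plus_r :: "('a::metric_space \<times> 'a) set set" where
  "O_plus_r = {\<tau> \<in> O_plus. \<exists>r. \<forall>x. (x, r) \<in> \<tau>}"

definition root_order :: "'a::metric_space \<Rightarrow> ('a \<times> 'a) set" where
  "root_order y = {(s, t). t \<in> seg y s}"

definition d_plus :: "'a::metric_space \<times> 'a \<Rightarrow> 'a \<times> 'a \<Rightarrow> real" where
  "d_plus p q = dist (fst p) (fst q) + dist (snd p) (snd q)"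

definition nbhd :: "real \<Rightarrow> ('a::metric_space \<times> 'a) set \<Rightarrow> ('a \<times> 'a) set" where
  "nbhd \<epsilon> W = {p. \<exists>q\<in>W. d_plus p q < \<epsilon>}"

definition Hd :: "('a::metric_space \<times> 'a) set \<Rightarrow> ('a \<times> 'a) set \<Rightarrow> real" where
  "Hd V W = Inf {\<epsilon>. \<epsilon> > 0 \<and> V \<subseteq> nbhd \<epsilon> W \<and> W \<subseteq> nbhd \<epsilon> V}"

definition Hd_open :: "('a::metric_space \<times> 'a) set set \<Rightarrow> bool" where
  "Hd_open U \<longleftrightarrow> U \<subseteq> O_plus_r \<and>
     (\<forall>\<tau>\<in>U. \<exists>\<epsilon>>0. \<forall>\<sigma>\<in>O_plus_r. Hd \<tau> \<sigma> < \<epsilon> \<longrightarrow> \<sigma> \<in> U)"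

definition U_set :: "'a::metric_space \<Rightarrow> 'a \<Rightarrow> ('a \<times> 'a) set set" where
  "U_set x y = {\<tau> \<in> O_plus. (x, y) \<in> \<tau>} - {root_order y}"

definition base_B :: "('a::metric_space \<times> 'a) set set set" where
  "base_B = {U. Hd_open U} \<union> {U_set x y | x y. x \<noteq> y}"

text \<open>Topology on the carrier O_+(X) generated by the base B
  (the whole carrier is declared open, as for any topology on O_+(X)).\<close>
definition O_plus_topology :: "('a::metric_space \<times> 'a) set topology" where
  "O_plus_topology = topology_generated_by (insert O_plus base_B)"

definition Cfun :: "('a::metric_space \<Rightarrow> real) set" where
  "Cfun = {f. continuous_on UNIV f}"

definition compact_open :: "('a::metric_space \<Rightarrow> real) topology" where
  "compact_open = topology_generated_by
     {{f \<in> Cfun. f ` K \<subseteq> U} | K U. compact K \<and> open U}"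

definition mod_const :: "('a::metric_space \<Rightarrow> real) \<Rightarrow> ('a \<Rightarrow> real) set" where
  "mod_const f = {g \<in> Cfun. \<exists>c. \<forall>y. g y = f y + c}"

definition quotient_topology :: "'a topology \<Rightarrow> ('a \<Rightarrow> 'b) \<Rightarrow> 'b topology" where
  "quotient_topology T q = topology (\<lambda>U. U \<subseteq> q ` topspace T \<and>
      openin T {x \<in> topspace T. q x \<in> U})"

definition C_mod_const :: "('a::metric_space \<Rightarrow> real) set topology" where
  "C_mod_const = quotient_topology compact_open mod_const"

definition d_emb :: "'a::metric_space \<Rightarrow> 'a \<Rightarrow> 'a \<Rightarrow> real" where
  "d_emb bp x = (\<lambda>y. dist x y - dist bp x)"

definition metric_compactification :: "'a::metric_space \<Rightarrow> ('a \<Rightarrow> real) set topology" where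
  "metric_compactification bp = subtopology C_mod_const
     (C_mod_const closure_of ((\<lambda>x. mod_const (d_emb bp x)) ` UNIV))"

end

theory Submission
  imports Defs
begin

text \<open>
  An order \<open>\<tau>\<close> in \<open>O\<^sub>+(X)\<close> carries the cocycle \<open>dist x j - dist y j\<close>, where \<open>j\<close> is the join of \<open>x\<close>
  and \<open>y\<close>; for the order rooted at \<open>z\<close> it is \<open>dist x z - dist y z\<close>. Integrating the cocycle gives a
  function \<open>h\<close>, unique up to a constant, from which \<open>\<tau>\<close> is recovered as \<open>h x - h y = dist x y\<close>. The
  functions obtained are exactly those which on every segment \<open>[x y]\<close> descend with unit slope from
  both ends to a common point, and these are exactly the limits of the functions \<open>d_z\<close>. By
  completeness the upper cones of an order without root are unbounded, so on a compact set \<open>h\<close>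
  coincides with \<open>d_y\<close> up to a constant as soon as \<open>y\<close> is high enough in the cone of the base point.
  This makes the correspondence continuous at unrooted orders and shows that rooted orders are dense.
\<close>

section \<open>Horofunctions and the orders they define\<close>

definition descent_order :: "('a::metric_space \<Rightarrow> real) \<Rightarrow> ('a \<times> 'a) set" where
  "descent_order h = {(x, y). h x - h y = dist x y}"

text \<open>In an R-tree the witness \<open>j\<close> is the join of \<open>x\<close> and
  \<open>y\<close> in \<open>descent_order h\<close>, as \<open>join_descent_order\<close>
  shows.\<close>

definition horofunction :: "('a::metric_space \<Rightarrow> real) \<Rightarrow> bool" where
  "horofunction h \<longleftrightarrow> (\<forall>x y. \<exists>j. dist x j + dist j y = dist x y \<and>
     h x - h j = dist x j \<and> h y - h j = dist y j)"

definition cocycle :: "('a::metric_space \<times> 'a) set \<Rightarrow> 'a \<Rightarrow> 'a \<Rightarrow> real" where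
  "cocycle \<tau> x y = dist x (join \<tau> x y) - dist y (join \<tau> x y)"

lemma descent_order_iff [simp]: "(x, y) \<in> descent_order h \<longleftrightarrow> h x - h y = dist x y"
  by (simp add: descent_order_def)

lemma horofunctionE:
  assumes "horofunction h"
  obtains j where "dist x j + dist j y = dist x y" "h x - h j = dist x j" "h y - h j = dist y j"
  using assms unfolding horofunction_def by meson

lemma horofunction_diff_le:
  assumes "horofunction h"
  shows "h x - h y \<le> dist x y"
proof -
  obtain j where "dist x j + dist j y = dist x y" "h x - h j = dist x j" "h y - h j = dist y j"
    using assms by (rule horofunctionE)
  then show ?thesis
    using zero_le_dist[of y j] dist_commute[of y j] by linarith
qed

lemma horofunction_abs_diff_le:
  assumes "horofunction h"
  shows "\<bar>h x - h y\<bar> \<le> dist x y"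
  using horofunction_diff_le[OF assms, of x y] horofunction_diff_le[OF assms, of y x]
  by (simp add: dist_commute)

lemma horofunction_Cfun:
  assumes "horofunction h"
  shows "h \<in> Cfun"
proof -
  have "1-lipschitz_on UNIV h"
    using horofunction_abs_diff_le[OF assms] by (auto simp: lipschitz_on_def dist_real_def)
  then show ?thesis
    by (auto simp: Cfun_def intro: lipschitz_on_continuous_on)
qed


subsection \<open>Semilattice orders and their cocycles\<close>

lemma is_sup_unique:
  assumes "antisym \<tau>" "is_sup \<tau> x y s" "is_sup \<tau> x y t"
  shows "s = t"
  using assms unfolding is_sup_def antisym_def by simp

lemma usms_refl: "usms \<tau> \<Longrightarrow> (x, x) \<in> \<tau>"
  by (simp add: usms_def partial_order_on_def preorder_on_def refl_on_def)

lemma usms_trans: "usms \<tau> \<Longrightarrow> (x, y) \<in> \<tau> \<Longrightarrow> (y, z) \<in> \<tau> \<Longrightarrow> (x, z) \<in> \<tau>"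
  unfolding usms_def partial_order_on_def preorder_on_def trans_def by fast

lemma usms_antisym: "usms \<tau> \<Longrightarrow> antisym \<tau>"
  by (simp add: usms_def partial_order_on_def)

lemma usms_dist_add:
  "usms \<tau> \<Longrightarrow> (x, z) \<in> \<tau> \<Longrightarrow> (z, y) \<in> \<tau> \<Longrightarrow> dist x z + dist z y = dist x y"
  unfolding usms_def by blast

lemma usms_linear:
  "usms \<tau> \<Longrightarrow> (x, y) \<in> \<tau> \<Longrightarrow> (x, z) \<in> \<tau> \<Longrightarrow> (y, z) \<in> \<tau> \<or> (z, y) \<in> \<tau>"
  unfolding usms_def by blast

lemma usms_dist_join:
  "usms \<tau> \<Longrightarrow> dist x (join \<tau> x y) + dist (join \<tau> x y) y = dist x y"
  unfolding usms_def by metis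

lemma join_eqI:
  assumes "antisym \<tau>" "is_sup \<tau> x y s"
  shows "join \<tau> x y = s"
  unfolding join_def using assms(2) is_sup_unique[OF assms(1) _ assms(2)] by (rule the_equality)

lemma usms_is_sup_join:
  assumes "usms \<tau>"
  shows "is_sup \<tau> x y (join \<tau> x y)"
proof -
  obtain s where s: "is_sup \<tau> x y s"
    using assms unfolding usms_def by meson
  then show ?thesis
    using join_eqI[OF usms_antisym[OF assms] s] by simp
qed

lemma usms_join_upper1: "usms \<tau> \<Longrightarrow> (x, join \<tau> x y) \<in> \<tau>"
  and usms_join_upper2: "usms \<tau> \<Longrightarrow> (y, join \<tau> x y) \<in> \<tau>"
  and usms_join_least: "usms \<tau> \<Longrightarrow> (x, u) \<in> \<tau> \<Longrightarrow> (y, u) \<in> \<tau> \<Longrightarrow> (join \<tau> x y, u) \<in> \<tau>"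
  using usms_is_sup_join[of \<tau> x y] unfolding is_sup_def by simp_all

text \<open>The stretch from the join up to \<open>u\<close> is common to both distances and
  cancels, so any common upper bound may replace the join.\<close>

lemma cocycle_upper_bound:
  assumes "usms \<tau>" "(x, u) \<in> \<tau>" "(y, u) \<in> \<tau>"
  shows "cocycle \<tau> x y = dist x u - dist y u"
  using usms_dist_add[OF assms(1) usms_join_upper1[OF assms(1)] usms_join_least[OF assms]]
    usms_dist_add[OF assms(1) usms_join_upper2[OF assms(1)] usms_join_least[OF assms]]
  unfolding cocycle_def by linarith

text \<open>All three values can be computed at one common upper bound of \<open>x\<close>,
  \<open>y\<close> and \<open>a\<close>, where the identity telescopes.\<close>

lemma cocycle_diff:
  assumes "usms \<tau>"
  shows "cocycle \<tau> x a - cocycle \<tau> y a = cocycle \<tau> x y"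
proof -
  define u where "u = join \<tau> (join \<tau> x y) a"
  have "(x, u) \<in> \<tau>" "(y, u) \<in> \<tau>" "(a, u) \<in> \<tau>"
    unfolding u_def by (meson assms usms_join_upper1 usms_join_upper2 usms_trans)+
  then show ?thesis
    using cocycle_upper_bound[OF assms] by simp
qed

text \<open>The extreme value leaves no length for the second leg of the path from \<open>x\<close>
  to \<open>y\<close> through the join, so the join is \<open>y\<close> itself.\<close>

lemma cocycle_eq_dist_iff:
  assumes "usms \<tau>"
  shows "cocycle \<tau> x y = dist x y \<longleftrightarrow> (x, y) \<in> \<tau>"
proof
  assume "(x, y) \<in> \<tau>"
  then show "cocycle \<tau> x y = dist x y"
    using cocycle_upper_bound[OF assms _ usms_refl[OF assms]] by simp
next
  assume "cocycle \<tau> x y = dist x y"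
  then have "dist (join \<tau> x y) y = 0"
    using usms_dist_join[OF assms, of x y] dist_commute[of y "join \<tau> x y"]
    unfolding cocycle_def by linarith
  then show "(x, y) \<in> \<tau>"
    using usms_join_upper1[OF assms, of x y] by simp
qed

lemma descent_order_cocycle:
  assumes "usms \<tau>"
  shows "descent_order (\<lambda>x. cocycle \<tau> x a) = \<tau>"
  using cocycle_eq_dist_iff[OF assms] by (auto simp: descent_order_def cocycle_diff[OF assms])

lemma horofunction_cocycle:
  assumes "usms \<tau>"
  shows "horofunction (\<lambda>x. cocycle \<tau> x a)"
  unfolding horofunction_def cocycle_diff[OF assms]
proof (intro allI exI conjI)
  fix x y
  show "dist x (join \<tau> x y) + dist (join \<tau> x y) y = dist x y"
    by (rule usms_dist_join[OF assms])
qed (simp_all add: cocycle_eq_dist_iff usms_join_upper1 usms_join_upper2 assms)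

text \<open>The join of \<open>x\<close> and \<open>a\<close> lies in the linearly ordered cone of
  \<open>a\<close>, at distance at most \<open>dist x a\<close>, hence below \<open>y\<close>. In
  this way a single point far up the cone dominates a whole bounded set.\<close>

lemma usms_upper_mem:
  assumes "usms \<tau>" "(a, y) \<in> \<tau>" "dist x a < dist a y"
  shows "(x, y) \<in> \<tau>"
proof -
  define j where "j = join \<tau> x a"
  have j: "(x, j) \<in> \<tau>" "(a, j) \<in> \<tau>" "dist x j + dist j a = dist x a"
    using usms_join_upper1 usms_join_upper2 usms_dist_join assms(1) by (auto simp: j_def)
  then consider "(j, y) \<in> \<tau>" | "(y, j) \<in> \<tau>"
    using usms_linear[OF assms(1) j(2) assms(2)] by blast
  then show ?thesis
  proof cases
    case 1
    then show ?thesis using usms_trans[OF assms(1) j(1)] by blast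
  next
    case 2
    then have "dist a y + dist y j = dist a j"
      using usms_dist_add assms by blast
    then show ?thesis
      using j(3) assms(3) zero_le_dist[of y j] zero_le_dist[of x j] dist_commute[of j a]
      by linarith
  qed
qed

text \<open>An upper cone embeds isometrically in the real line by the distance to its
  vertex.\<close>

lemma usms_cone_dist:
  assumes "usms \<tau>" "(a, y) \<in> \<tau>" "(a, z) \<in> \<tau>"
  shows "dist y z = \<bar>dist a y - dist a z\<bar>"
  using usms_linear[OF assms]
proof
  assume "(y, z) \<in> \<tau>"
  then have "dist a y + dist y z = dist a z"
    using usms_dist_add assms(1,2) by blast
  then show ?thesis
    using zero_le_dist[of y z] by linarith
next
  assume "(z, y) \<in> \<tau>"
  then have "dist a z + dist z y = dist a y"
    using usms_dist_add assms(1,3) by blast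
  then show ?thesis
    using zero_le_dist[of z y] dist_commute[of y z] by linarith
qed

lemma usms_cone_le:
  assumes "usms \<tau>" "(a, y) \<in> \<tau>" "(a, z) \<in> \<tau>" "dist a y \<le> dist a z"
  shows "(y, z) \<in> \<tau>"
proof (cases "(y, z) \<in> \<tau>")
  case False
  then have "(z, y) \<in> \<tau>"
    using usms_linear assms by blast
  then have "dist a z + dist z y = dist a y"
    using usms_dist_add assms by blast
  then have "dist z y = 0"
    using assms(4) zero_le_dist[of z y] by linarith
  then have "z = y"
    by simp
  then show ?thesis
    using usms_refl[OF assms(1)] by simp
qed

text \<open>The join of any \<open>w\<close> with \<open>a\<close> lies in the cone of
  \<open>a\<close>, and there \<open>m\<close> is on top because distance to \<open>a\<close>
  determines the order.\<close>

lemma farthest_in_cone_is_root: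
  assumes "usms \<tau>" "(a, m) \<in> \<tau>" "\<And>y. (a, y) \<in> \<tau> \<Longrightarrow> dist a y \<le> dist a m"
  shows "(w, m) \<in> \<tau>"
proof -
  have "(join \<tau> w a, m) \<in> \<tau>"
    using usms_cone_le[OF assms(1) usms_join_upper2[OF assms(1)] assms(2)] assms(3)
      usms_join_upper2[OF assms(1)] by blast
  then show ?thesis
    using usms_trans usms_join_upper1 assms(1) by blast
qed

text \<open>If the distances in the cone were bounded, points approaching their supremum would form
  a Cauchy sequence. Its limit would have to be a root, or else stay at positive distance from the
  sequence.\<close>

lemma unrooted_cone_unbounded:
  fixes \<tau> :: "('a::metric_space \<times> 'a) set"
  assumes "usms \<tau>" "\<tau> \<notin> O_plus_r" "complete (UNIV :: 'a set)"
  shows "\<exists>y. (a, y) \<in> \<tau> \<and> R < dist a y"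
proof (rule ccontr)
  assume "\<not> ?thesis"
  then have bound: "dist a y \<le> R" if "(a, y) \<in> \<tau>" for y
    using that by force
  define S where "S = (SUP y\<in>{y. (a, y) \<in> \<tau>}. dist a y)"
  have bdd: "bdd_above (dist a ` {y. (a, y) \<in> \<tau>})"
    using bound by (auto intro!: bdd_aboveI)
  have ne: "dist a ` {y. (a, y) \<in> \<tau>} \<noteq> {}"
    using usms_refl[OF assms(1)] by blast
  have le_S: "dist a y \<le> S" if "(a, y) \<in> \<tau>" for y
    unfolding S_def using that by (intro cSUP_upper[OF _ bdd]) auto
  \<comment> \<open>An attained supremum would give a farthest point of the cone, which is a
    root.\<close>
  have lt_S: "dist a y < S" if "(a, y) \<in> \<tau>" for y
  proof (rule ccontr)
    assume "\<not> dist a y < S"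
    then have "\<And>w. (w, y) \<in> \<tau>"
      using farthest_in_cone_is_root[OF assms(1) that] le_S by force
    then show False
      using assms(1,2) by (auto simp: O_plus_r_def O_plus_def)
  qed
  have "\<exists>y. (a, y) \<in> \<tau> \<and> S - inverse (real (Suc n)) < dist a y" for n
    using less_cSUP_iff[OF _ bdd, of "S - inverse (real (Suc n))"] ne
    unfolding S_def[symmetric] by auto
  then obtain y where y: "\<And>n. (a, y n) \<in> \<tau>" "\<And>n. S - inverse (real (Suc n)) < dist a (y n)"
    by metis
  have lim: "(\<lambda>n. dist a (y n)) \<longlonglongrightarrow> S"
  proof (rule tendsto_sandwich)
    show "(\<lambda>n. S - inverse (real (Suc n))) \<longlonglongrightarrow> S"
      using tendsto_diff[OF tendsto_const LIMSEQ_inverse_real_of_nat, of S] by simp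
    show "(\<lambda>_. S) \<longlonglongrightarrow> S" by simp
  qed (use y le_S in \<open>auto intro!: always_eventually less_imp_le\<close>)
  then have "Cauchy (\<lambda>n. dist a (y n))"
    by (rule LIMSEQ_imp_Cauchy)
  then have "Cauchy y"
    using usms_cone_dist[OF assms(1) y(1) y(1)] by (simp add: Cauchy_def dist_real_def)
  then obtain r where r: "y \<longlonglongrightarrow> r"
    using assms(3) by (auto simp: complete_def)
  \<comment> \<open>The limit \<open>r\<close> is not known to lie in the cone of \<open>a\<close>,
    but its join with \<open>a\<close> does, and so it lies strictly below the level
    \<open>S\<close>.\<close>
  define j where "j = join \<tau> r a"
  have j: "(r, j) \<in> \<tau>" "(a, j) \<in> \<tau>"
    using usms_join_upper1 usms_join_upper2 assms(1) by (auto simp: j_def)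
  have "\<forall>\<^sub>F n in sequentially. dist a j < dist a (y n)"
    using order_tendstoD(1)[OF lim lt_S[OF j(2)]] .
  \<comment> \<open>Eventually \<open>y n\<close> lies above \<open>j\<close>, so the way from
    \<open>r\<close> to \<open>y n\<close> passes through \<open>j\<close>. In the limit this keeps
    \<open>r\<close> at distance at least \<open>S - dist a j > 0\<close> from the sequence.\<close>
  then have "\<forall>\<^sub>F n in sequentially. dist a (y n) - dist a j \<le> dist r (y n)"
  proof eventually_elim
    case (elim n)
    then have "(j, y n) \<in> \<tau>"
      using usms_cone_le[OF assms(1) j(2) y(1)] by simp
    then have "dist r j + dist j (y n) = dist r (y n)" "dist a j + dist j (y n) = dist a (y n)"
      using usms_dist_add[OF assms(1)] j by blast+
    then show ?case
      using zero_le_dist[of r j] by linarith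
  qed
  moreover have "(\<lambda>n. dist a (y n) - dist a j) \<longlonglongrightarrow> S - dist a j"
    by (intro tendsto_intros lim)
  moreover have "(\<lambda>n. dist r (y n)) \<longlonglongrightarrow> dist r r"
    by (intro tendsto_intros r)
  ultimately have "S - dist a j \<le> dist r r"
    using tendsto_le[OF sequentially_bot] by blast
  then show False
    using lt_S[OF j(2)] by simp
qed

lemma maximal_imp_greatest:
  assumes "usms \<tau>" "\<And>z. (y, z) \<in> \<tau> \<Longrightarrow> z = y"
  shows "(w, y) \<in> \<tau>"
  using farthest_in_cone_is_root[OF assms(1) usms_refl[OF assms(1)]] assms(2) by fastforce


subsection \<open>Metric geometry of R-trees\<close>

locale rtree =
  fixes T :: "'a::metric_space itself"
  assumes R_tree: "R_tree TYPE('a)"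
begin

lemma is_segment_seg: "is_segment x y (seg x (y::'a))"
  unfolding seg_def using R_tree theI'[of "is_segment x y"] by (simp add: R_tree_def)

lemma is_segment_eq_seg: "is_segment x y S \<Longrightarrow> S = seg x (y::'a)"
  using is_segment_seg R_tree unfolding R_tree_def by blast

text \<open>A point with additive distances lies on the segment because geodesics from
  \<open>x\<close> to \<open>t\<close> and from \<open>t\<close> to \<open>y\<close> concatenate to
  a geodesic, whose image is the segment by uniqueness.\<close>

lemma seg_eq: "seg x y = {t::'a. dist x t + dist t y = dist x y}"
proof (intro subset_antisym subsetI)
  fix t assume "t \<in> seg x y"
  then obtain \<gamma> s where "\<gamma> 0 = x" "\<gamma> (dist x y) = y"
    "\<And>s t. s \<in> {0..dist x y} \<Longrightarrow> t \<in> {0..dist x y} \<Longrightarrow> dist (\<gamma> s) (\<gamma> t) = \<bar>s - t\<bar>"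
    "s \<in> {0..dist x y}" "t = \<gamma> s"
    using is_segment_seg[of x y] unfolding is_segment_def by force
  from this(3)[of 0 s] this(3)[of s "dist x y"] this
  show "t \<in> {t. dist x t + dist t y = dist x y}"
    by simp
next
  fix t assume "t \<in> {t. dist x t + dist t y = dist x y}"
  then have t: "dist x t + dist t y = dist x y" by simp
  define a b where "a = dist x t" and "b = dist t y"
  have ab: "a \<ge> 0" "b \<ge> 0" "dist x y = a + b"
    using t by (auto simp: a_def b_def)
  obtain \<gamma> where \<gamma>: "\<gamma> 0 = x" "\<gamma> a = t"
    "\<And>s u. s \<in> {0..a} \<Longrightarrow> u \<in> {0..a} \<Longrightarrow> dist (\<gamma> s) (\<gamma> u) = \<bar>s - u\<bar>"
    using is_segment_seg[of x t] unfolding is_segment_def a_def by force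
  obtain \<delta> where \<delta>: "\<delta> 0 = t" "\<delta> b = y"
    "\<And>s u. s \<in> {0..b} \<Longrightarrow> u \<in> {0..b} \<Longrightarrow> dist (\<delta> s) (\<delta> u) = \<bar>s - u\<bar>"
    using is_segment_seg[of t y] unfolding is_segment_def b_def by force
  define \<eta> where "\<eta> s = (if s \<le> a then \<gamma> s else \<delta> (s - a))" for s
  \<comment> \<open>Going through \<open>t\<close> bounds the distance from above; anything shorter
    would give a path from \<open>x\<close> to \<open>y\<close> of length less than
    \<open>dist x y\<close>.\<close>
  have cross: "dist (\<gamma> s) (\<delta> u) = a - s + u" if "s \<in> {0..a}" "u \<in> {0..b}" for s u
  proof -
    have "dist x (\<gamma> s) = s" "dist (\<gamma> s) t = a - s" "dist t (\<delta> u) = u" "dist (\<delta> u) y = b - u"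
      using \<gamma>(3)[of 0 s] \<gamma>(3)[of s a] \<delta>(3)[of 0 u] \<delta>(3)[of u b] that \<gamma>(1,2) \<delta>(1,2) by auto
    then show ?thesis
      using dist_triangle[of "\<gamma> s" "\<delta> u" t] dist_triangle[of x y "\<gamma> s"]
        dist_triangle[of "\<gamma> s" y "\<delta> u"] ab(3) by linarith
  qed
  have "dist (\<eta> s) (\<eta> u) = \<bar>s - u\<bar>" if "s \<in> {0..a + b}" "u \<in> {0..a + b}" for s u
    using that \<gamma>(3)[of s u] \<delta>(3)[of "s - a" "u - a"] cross[of s "u - a"] cross[of u "s - a"]
    by (auto simp: \<eta>_def dist_commute)
  moreover have "\<eta> 0 = x" "\<eta> (a + b) = y" "\<eta> a = t"
    using \<gamma> \<delta> ab by (auto simp: \<eta>_def)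
  ultimately have "is_segment x y (\<eta> ` {0..a + b})"
    unfolding is_segment_def ab(3) by blast
  then have "\<eta> ` {0..a + b} = seg x y"
    by (rule is_segment_eq_seg)
  then show "t \<in> seg x y"
    using \<open>\<eta> a = t\<close> ab by force
qed

lemma point_on_segment:
  assumes "0 \<le> r" "r \<le> dist x (y::'a)"
  obtains t where "dist x t + dist t y = dist x y" "dist x t = r"
proof -
  obtain \<gamma> where \<gamma>: "\<gamma> 0 = x" "\<gamma> (dist x y) = y"
    "\<And>s t. s \<in> {0..dist x y} \<Longrightarrow> t \<in> {0..dist x y} \<Longrightarrow> dist (\<gamma> s) (\<gamma> t) = \<bar>s - t\<bar>"
    using is_segment_seg[of x y] unfolding is_segment_def by force
  show ?thesis
    using \<gamma>(3)[of 0 r] \<gamma>(3)[of r "dist x y"] \<gamma>(1,2) assms by (intro that[of "\<gamma> r"]) auto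
qed

lemma dist_on_segment:
  assumes "dist x s + dist s y = dist x (y::'a)" "dist x t + dist t y = dist x y"
  shows "dist s t = \<bar>dist x s - dist x t\<bar>"
proof -
  obtain \<gamma> where \<gamma>: "\<gamma> 0 = x"
    "\<And>s t. s \<in> {0..dist x y} \<Longrightarrow> t \<in> {0..dist x y} \<Longrightarrow> dist (\<gamma> s) (\<gamma> t) = \<bar>s - t\<bar>"
    "seg x y = \<gamma> ` {0..dist x y}"
    using is_segment_seg[of x y] unfolding is_segment_def by force
  have "s \<in> \<gamma> ` {0..dist x y}" "t \<in> \<gamma> ` {0..dist x y}"
    using assms \<gamma>(3) seg_eq by auto
  then obtain u v where "u \<in> {0..dist x y}" "s = \<gamma> u" "v \<in> {0..dist x y}" "t = \<gamma> v"
    by blast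
  then show ?thesis
    using \<gamma>(2)[of u v] \<gamma>(2)[of 0 u] \<gamma>(2)[of 0 v] \<gamma>(1) by simp
qed

text \<open>The median is found as the point of \<open>[x y]\<close> whose distance to \<open>x\<close> is the Gromov product of
  \<open>y\<close> and \<open>z\<close>.\<close>

lemma median:
  obtains m :: 'a where "dist x m + dist m y = dist x y" "dist x m + dist m z = dist x z"
    "dist y m + dist m z = dist y z"
proof -
  define r where "r = (dist x y + dist x z - dist y z) / 2"
  have "0 \<le> r" "r \<le> dist x y"
    using dist_triangle[of y z x] dist_triangle[of x z y] by (auto simp: r_def dist_commute)
  then obtain m where m: "dist x m + dist m y = dist x y" "dist x m = r"
    by (rule point_on_segment)
  \<comment> \<open>The tripod axiom yields one of the two remaining equations, and the choice of
    \<open>r\<close> turns either of them into the other.\<close>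
  have "m \<in> seg x z \<union> seg z y"
    using R_tree m unfolding R_tree_def seg_eq by blast
  then have "dist x m + dist m z = dist x z \<or> dist y m + dist m z = dist y z"
    by (auto simp: seg_eq dist_commute add.commute)
  then show ?thesis
    using m by (intro that[of m]) (auto simp: r_def dist_commute field_simps)
qed

section \<open>Orders defined by horofunctions on an R-tree\<close>

lemma horofunction_dist: "horofunction (dist (z::'a))"
  unfolding horofunction_def
proof (intro allI)
  fix x y
  show "\<exists>j. dist x j + dist j y = dist x y \<and> dist z x - dist z j = dist x j \<and> dist z y - dist z j = dist y j"
    by (rule median[of x y z]) (smt (verit) dist_commute)
qed

lemma root_order_eq: "root_order (z::'a) = descent_order (dist z)"
  by (auto simp: root_order_def descent_order_def seg_eq dist_commute)

text \<open>With \<open>j\<close> the meeting point of the descents from \<open>y\<close> and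
  \<open>z\<close>, the function falls with unit slope from \<open>x\<close> to \<open>j\<close>
  through \<open>y\<close> and also through \<open>z\<close>. Both points therefore lie on
  \<open>[x j]\<close>, where distance to \<open>x\<close> compares them.\<close>

lemma descent_order_linear:
  assumes "horofunction h" "h x - h y = dist x (y::'a)" "h x - h z = dist x z"
  shows "h y - h z = dist y z \<or> h z - h y = dist z y"
proof -
  obtain j where j: "dist y j + dist j z = dist y z" "h y - h j = dist y j" "h z - h j = dist z j"
    using assms(1) by (rule horofunctionE)
  have "dist x y + dist y j = dist x j" "dist x z + dist z j = dist x j"
    using assms j horofunction_diff_le[OF assms(1), of x j] dist_triangle[of x j y]
      dist_triangle[of x j z] by linarith+
  then have "dist y z = \<bar>dist x y - dist x z\<bar>"
    by (rule dist_on_segment)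
  then show ?thesis
    using assms(2,3) by (auto simp: dist_commute)
qed

text \<open>An upper bound \<open>u\<close> is comparable with \<open>j\<close>, since both lie
  above \<open>x\<close>. Were \<open>u\<close> below \<open>j\<close>, the path from
  \<open>x\<close> to \<open>y\<close> through \<open>u\<close> would be shorter by
  \<open>2 * dist u j\<close>, which forces \<open>u = j\<close>.\<close>

lemma is_sup_descent_order:
  assumes "horofunction h" "dist x j + dist j y = dist x (y::'a)"
    "h x - h j = dist x j" "h y - h j = dist y j"
  shows "is_sup (descent_order h) x y j"
proof -
  have "h j - h u = dist j u" if "h x - h u = dist x u" "h y - h u = dist y u" for u
    using descent_order_linear[OF assms(1,3) that(1)] dist_triangle[of x y u] assms that
    by (smt (verit) dist_commute zero_le_dist)
  then show ?thesis
    using assms by (auto simp: is_sup_def)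
qed

lemma antisym_descent_order: "antisym (descent_order (h :: 'a \<Rightarrow> real))"
proof (rule antisymI)
  fix x y assume "(x, y) \<in> descent_order h" "(y, x) \<in> descent_order h"
  then have "dist x y = 0"
    unfolding descent_order_iff using dist_commute[of x y] by linarith
  then show "x = y" by simp
qed

lemma join_descent_order:
  fixes x y :: 'a
  assumes "horofunction h"
  defines "j \<equiv> join (descent_order h) x y"
  shows "dist x j + dist j y = dist x y" "h x - h j = dist x j" "h y - h j = dist y j"
proof -
  obtain k where k: "dist x k + dist k y = dist x y" "h x - h k = dist x k" "h y - h k = dist y k"
    using assms(1) by (rule horofunctionE)
  have "j = k"
    unfolding j_def
    by (rule join_eqI[OF antisym_descent_order is_sup_descent_order[OF assms(1) k]])
  then show "dist x j + dist j y = dist x y" "h x - h j = dist x j" "h y - h j = dist y j"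
    using k by simp_all
qed

lemma usms_descent_order:
  assumes "horofunction (h :: 'a \<Rightarrow> real)"
  shows "usms (descent_order h)"
  unfolding usms_def
proof (intro conjI allI impI)
  have "trans (descent_order h)"
  proof (rule transI)
    fix x y z assume "(x, y) \<in> descent_order h" "(y, z) \<in> descent_order h"
    then show "(x, z) \<in> descent_order h"
      using horofunction_diff_le[OF assms, of x z] dist_triangle[of x z y] by simp
  qed
  then show "partial_order_on UNIV (descent_order h)"
    using antisym_descent_order by (auto simp: partial_order_on_def preorder_on_def refl_on_def)
  show "\<exists>s. is_sup (descent_order h) x y s" for x y
    using horofunctionE[OF assms] is_sup_descent_order[OF assms] by blast
  show "dist x z + dist z y = dist x y"
    if "(x, z) \<in> descent_order h \<and> (z, y) \<in> descent_order h" for x y z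
    using that horofunction_diff_le[OF assms, of x y] dist_triangle[of x y z] by simp
  show "dist x y = dist x (join (descent_order h) x y) + dist (join (descent_order h) x y) y" for x y
    by (rule join_descent_order(1)[OF assms, symmetric])
  show "(y, z) \<in> descent_order h \<or> (z, y) \<in> descent_order h"
    if "(x, y) \<in> descent_order h \<and> (x, z) \<in> descent_order h" for x y z
    using descent_order_linear[OF assms] that unfolding descent_order_iff by blast
qed

text \<open>Together with \<open>descent_order_cocycle\<close> this makes orders and horofunctions
  modulo constants correspond bijectively.\<close>

lemma cocycle_descent_order:
  assumes "horofunction (h :: 'a \<Rightarrow> real)"
  shows "cocycle (descent_order h) x y = h x - h y"
  using join_descent_order(2)[OF assms, of x y] join_descent_order(3)[OF assms, of y x]
  unfolding cocycle_def by linarith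


subsection \<open>Rooted orders\<close>

lemma usms_root_order: "usms (root_order (z::'a))"
  unfolding root_order_eq by (rule usms_descent_order[OF horofunction_dist])

lemma root_order_root: "(x, z) \<in> root_order (z::'a)"
  by (simp add: root_order_eq dist_commute)

lemma rooted_eq_root_order:
  assumes "usms \<tau>" "\<And>x. (x, r) \<in> \<tau>"
  shows "\<tau> = root_order (r::'a)"
proof -
  have "cocycle \<tau> x r = dist r x" for x
    using cocycle_eq_dist_iff[OF assms(1), of x r] assms(2)[of x] dist_commute[of x r] by simp
  then show ?thesis
    using descent_order_cocycle[OF assms(1), of r] by (simp add: root_order_eq)
qed

lemma O_plus_r_eq: "O_plus_r = range (root_order :: 'a \<Rightarrow> _)"
proof (intro subset_antisym subsetI)
  fix \<tau> :: "('a \<times> 'a) set" assume "\<tau> \<in> O_plus_r"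
  then show "\<tau> \<in> range root_order"
    using rooted_eq_root_order by (auto simp: O_plus_r_def O_plus_def)
next
  fix \<tau> :: "('a \<times> 'a) set" assume "\<tau> \<in> range root_order"
  then show "\<tau> \<in> O_plus_r"
    using root_order_root usms_root_order by (auto simp: O_plus_r_def O_plus_def)
qed

lemma inj_root_order: "inj (root_order :: 'a \<Rightarrow> _)"
proof (rule injI)
  fix y z :: 'a assume "root_order y = root_order z"
  then have "(z, y) \<in> root_order z" "(y, z) \<in> root_order z"
    using root_order_root by metis+
  then show "y = z"
    using usms_antisym[OF usms_root_order] by (meson antisymD)
qed

text \<open>A pair \<open>(s, t)\<close> is corrected in its second entry only. With
  \<open>m\<close> the median of \<open>y\<close>, \<open>s\<close> and \<open>z\<close>, the point
  \<open>t\<close> is kept if it lies between \<open>m\<close> and \<open>s\<close>, and is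
  otherwise pushed to \<open>m\<close>, over a distance of at most \<open>dist y z\<close>.\<close>

lemma root_order_subset_nbhd:
  assumes "dist y z < \<epsilon>"
  shows "root_order y \<subseteq> nbhd \<epsilon> (root_order (z::'a))"
proof
  fix p assume p: "p \<in> root_order y"
  obtain s t where p_eq: "p = (s, t)" by fastforce
  have t: "dist y t + dist t s = dist y s"
    using p by (simp add: p_eq root_order_eq dist_commute)
  obtain m where m: "dist y m + dist m s = dist y s" "dist y m + dist m z = dist y z"
    "dist s m + dist m z = dist s z"
    by (rule median)
  have tm: "dist t m = \<bar>dist y t - dist y m\<bar>"
    using dist_on_segment[OF t m(1)] .
  have "\<exists>u. dist z s - dist z u = dist s u \<and> dist t u < \<epsilon>"
  proof (cases "dist y m \<le> dist y t")
    case True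
    have "dist z s - dist z t = dist s t"
      using True tm t m dist_triangle[of z t m] dist_triangle[of z s t] by (simp add: dist_commute)
    then show ?thesis
      using assms by (intro exI[of _ t]) (smt (verit) dist_self zero_le_dist)
  next
    case False
    then have "dist t m < \<epsilon>"
      using tm m(2) assms zero_le_dist[of y t] zero_le_dist[of m z] by linarith
    then show ?thesis
      using m by (intro exI[of _ m]) (simp add: dist_commute)
  qed
  then obtain u where "(s, u) \<in> root_order z" "dist t u < \<epsilon>"
    by (auto simp: root_order_eq)
  then show "p \<in> nbhd \<epsilon> (root_order z)"
    unfolding nbhd_def p_eq d_plus_def by (intro CollectI bexI[of _ "(s, u)"]) auto
qed

text \<open>The pair \<open>(z, y)\<close> is the test case: a pair \<open>(s, t)\<close> of the
  order rooted at \<open>z\<close> satisfies \<open>dist z t \<le> dist z s\<close>, so it is at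
  distance at least \<open>dist y z\<close> from \<open>(z, y)\<close>.\<close>

lemma dist_less_if_nbhd_root_order:
  assumes "root_order y \<subseteq> nbhd \<epsilon> (root_order (z::'a))"
  shows "dist y z < \<epsilon>"
proof -
  have "(z, y) \<in> nbhd \<epsilon> (root_order z)"
    using assms root_order_root by blast
  then obtain s t where "dist z s - dist z t = dist s t" "dist z s + dist y t < \<epsilon>"
    by (auto simp: nbhd_def d_plus_def root_order_eq)
  then show ?thesis
    using dist_triangle[of y z t] zero_le_dist[of s t] dist_commute[of z t] by linarith
qed

lemma Hd_root_order: "Hd (root_order y) (root_order (z::'a)) = dist y z"
proof -
  have "{\<epsilon>. \<epsilon> > 0 \<and> root_order y \<subseteq> nbhd \<epsilon> (root_order z) \<and> root_order z \<subseteq> nbhd \<epsilon> (root_order y)}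
    = {dist y z<..}"
    using root_order_subset_nbhd[of y z] root_order_subset_nbhd[of z y] dist_less_if_nbhd_root_order[of y _ z]
    by (auto simp: dist_commute intro: le_less_trans[OF zero_le_dist])
  then show ?thesis
    by (simp add: Hd_def)
qed

end


subsection \<open>The compact-open topology modulo constants\<close>

lemma openin_quotient_topology:
  "openin (quotient_topology T q) U \<longleftrightarrow> U \<subseteq> q ` topspace T \<and> openin T {x \<in> topspace T. q x \<in> U}"
proof -
  have "istopology (\<lambda>U. U \<subseteq> q ` topspace T \<and> openin T {x \<in> topspace T. q x \<in> U})"
    unfolding istopology_def
  proof (intro conjI allI impI)
    fix S S'
    assume "S \<subseteq> q ` topspace T \<and> openin T {x \<in> topspace T. q x \<in> S}"
      and "S' \<subseteq> q ` topspace T \<and> openin T {x \<in> topspace T. q x \<in> S'}"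
    moreover have "{x \<in> topspace T. q x \<in> S \<inter> S'} =
        {x \<in> topspace T. q x \<in> S} \<inter> {x \<in> topspace T. q x \<in> S'}"
      by blast
    ultimately show "S \<inter> S' \<subseteq> q ` topspace T" "openin T {x \<in> topspace T. q x \<in> S \<inter> S'}"
      by auto
  next
    fix \<K>
    assume K: "\<forall>K\<in>\<K>. K \<subseteq> q ` topspace T \<and> openin T {x \<in> topspace T. q x \<in> K}"
    have "{x \<in> topspace T. q x \<in> \<Union>\<K>} = (\<Union>K\<in>\<K>. {x \<in> topspace T. q x \<in> K})"
      by blast
    then show "\<Union>\<K> \<subseteq> q ` topspace T" "openin T {x \<in> topspace T. q x \<in> \<Union>\<K>}"
      using K by auto
  qed
  then show ?thesis
    by (simp add: quotient_topology_def)
qed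

lemma topspace_compact_open [simp]: "topspace compact_open = Cfun"
proof -
  have "Cfun = {f \<in> Cfun. f ` {} \<subseteq> (UNIV :: real set)}"
    by simp
  then have "Cfun \<in> {{f \<in> Cfun. f ` K \<subseteq> U} | K U. compact K \<and> open U}"
    using compact_empty open_UNIV by blast
  then show ?thesis
    by (auto simp: compact_open_def)
qed

lemma openin_compact_open_image_subset:
  assumes "compact K" "open U"
  shows "openin compact_open {f \<in> Cfun. f ` K \<subseteq> U}"
  unfolding compact_open_def using assms by (intro topology_generated_by_Basis) blast

text \<open>A subbasic set constrains values on one compact set only, and a finite intersection on
  the union of finitely many. Exact agreement on \<open>K\<close> is enough here, since distance
  functions to high points of a cone achieve it up to a constant.\<close>

lemma openin_compact_open_agree_on_compact:
  assumes "openin compact_open W" "f \<in> W"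
  shows "\<exists>K. compact K \<and> (\<forall>g\<in>Cfun. (\<forall>x\<in>K. g x = f x) \<longrightarrow> g \<in> W)"
proof -
  have "generate_topology_on {{f \<in> Cfun. f ` K \<subseteq> U} | K U. compact K \<and> open U} W"
    using assms(1) unfolding compact_open_def by (rule openin_topology_generated_by)
  then show ?thesis
    using assms(2)
  proof induction
    case (Int a b)
    then obtain K L where "compact K" "\<forall>g\<in>Cfun. (\<forall>x\<in>K. g x = f x) \<longrightarrow> g \<in> a"
      "compact L" "\<forall>g\<in>Cfun. (\<forall>x\<in>L. g x = f x) \<longrightarrow> g \<in> b"
      by auto
    then show ?case
      by (intro exI[of _ "K \<union> L"]) (auto intro: compact_Un)
  next
    case (UN \<K>)
    then obtain W' where W': "W' \<in> \<K>" "f \<in> W'" by blast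
    then obtain K where "compact K" "\<forall>g\<in>Cfun. (\<forall>x\<in>K. g x = f x) \<longrightarrow> g \<in> W'"
      using UN.IH by blast
    then show ?case
      using W'(1) by blast
  next
    case (Basis s)
    then obtain K U where K: "s = {f \<in> Cfun. f ` K \<subseteq> U}" "compact K"
      by blast
    then have "\<forall>g\<in>Cfun. (\<forall>x\<in>K. g x = f x) \<longrightarrow> g \<in> s"
      using Basis(2) by force
    then show ?case
      using K(2) by blast
  qed simp
qed

lemma continuous_map_eval: "continuous_map compact_open euclideanreal (\<lambda>f. f p)"
  unfolding continuous_map_def
proof (intro conjI allI impI)
  fix U :: "real set" assume "openin euclideanreal U"
  then have "openin compact_open {f \<in> Cfun. f ` {p} \<subseteq> U}"
    by (intro openin_compact_open_image_subset) auto
  then show "openin compact_open {f \<in> topspace compact_open. f p \<in> U}"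
    by simp
qed auto

text \<open>Conditions on differences of values survive adding a constant, so such sets descend to
  open sets of the quotient.\<close>

lemma openin_compact_open_diff_gt: "openin compact_open {f \<in> Cfun. f p - f q > c}"
proof -
  have "continuous_map compact_open euclideanreal (\<lambda>f. f p - f q)"
    by (intro continuous_map_diff continuous_map_eval)
  from openin_continuous_map_preimage[OF this, of "{c<..}"] show ?thesis
    by simp
qed

lemma openin_compact_open_diff_near:
  "openin compact_open {f \<in> Cfun. \<bar>f p - f q - c\<bar> < e}"
proof -
  have "continuous_map compact_open euclideanreal (\<lambda>f. f p - f q)"
    by (intro continuous_map_diff continuous_map_eval)
  from openin_continuous_map_preimage[OF this, of "{c - e<..<c + e}"] show ?thesis
    by (simp add: abs_less_iff algebra_simps conj_commute)
qed

text \<open>A continuous function attains its minimum on a nonempty compact \<open>K\<close>, so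
  some constant \<open>c\<close> separates \<open>f z\<close> from the values on \<open>K\<close>;
  for fixed \<open>c\<close> the condition is an intersection of two subbasic sets.\<close>

lemma openin_compact_open_less_on_compact:
  assumes "compact K"
  shows "openin compact_open {f \<in> Cfun. \<forall>x\<in>K. f z < f x}"
proof -
  have "\<exists>c. f z < c \<and> (\<forall>x\<in>K. c < f x)" if f: "f \<in> Cfun" "\<forall>x\<in>K. f z < f x" for f
  proof (cases "K = {}")
    case False
    then obtain m where "m \<in> K" "\<forall>x\<in>K. f m \<le> f x"
      using continuous_attains_inf[OF assms, of f] continuous_on_subset[of UNIV f K] f(1)
      by (auto simp: Cfun_def)
    moreover obtain c where "f z < c" "c < f m"
      using f(2) \<open>m \<in> K\<close> dense by blast
    ultimately show ?thesis
      by force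
  qed (auto intro: gt_ex)
  then have "\<And>f. f \<in> Cfun \<and> (\<forall>x\<in>K. f z < f x) \<longleftrightarrow> f \<in> Cfun \<and> (\<exists>c. f z < c \<and> (\<forall>x\<in>K. c < f x))"
    by (meson less_trans)
  then have "{f \<in> Cfun. \<forall>x\<in>K. f z < f x} =
      (\<Union>c. {f \<in> Cfun. f ` {z} \<subseteq> {..<c}} \<inter> {f \<in> Cfun. f ` K \<subseteq> {c<..}})"
    by (simp add: set_eq_iff image_subset_iff) blast
  moreover have "openin compact_open ({f \<in> Cfun. f ` {z} \<subseteq> {..<c}} \<inter> {f \<in> Cfun. f ` K \<subseteq> {c<..}})" for c
    by (intro openin_Int openin_compact_open_image_subset assms) auto
  ultimately show ?thesis
    by (metis (no_types, lifting) openin_Union imageE)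
qed

lemma mod_const_eq_iff:
  assumes "f \<in> Cfun" "g \<in> Cfun"
  shows "mod_const f = mod_const g \<longleftrightarrow> (\<exists>c. \<forall>x. f x = g x + c)"
proof
  assume "mod_const f = mod_const g"
  moreover have "f \<in> mod_const f"
    using assms(1) by (auto simp: mod_const_def intro: exI[of _ 0])
  ultimately show "\<exists>c. \<forall>x. f x = g x + c"
    by (auto simp: mod_const_def)
next
  assume "\<exists>c. \<forall>x. f x = g x + c"
  then obtain c where c: "\<And>x. f x = g x + c" by blast
  have "(\<exists>d. \<forall>x. k x = f x + d) \<longleftrightarrow> (\<exists>d. \<forall>x. k x = g x + d)" for k
    unfolding c by (metis add.assoc diff_add_cancel add.commute)
  then show "mod_const f = mod_const g"
    by (simp add: mod_const_def)
qed

lemma openin_C_mod_const: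
  "openin C_mod_const U \<longleftrightarrow> U \<subseteq> mod_const ` Cfun \<and> openin compact_open {f \<in> Cfun. mod_const f \<in> U}"
  by (simp add: C_mod_const_def openin_quotient_topology)

lemma topspace_C_mod_const [simp]: "topspace C_mod_const = mod_const ` Cfun"
proof -
  have "openin C_mod_const (mod_const ` Cfun)"
  proof -
    have "{f \<in> Cfun. mod_const f \<in> mod_const ` Cfun} = topspace compact_open"
      by auto
    then show ?thesis
      unfolding openin_C_mod_const by (metis openin_topspace subset_refl)
  qed
  moreover have "topspace C_mod_const \<subseteq> mod_const ` Cfun"
    using openin_C_mod_const openin_topspace by blast
  ultimately show ?thesis
    using openin_subset by blast
qed

lemma continuous_map_mod_const: "continuous_map compact_open C_mod_const mod_const"
  by (auto simp: continuous_map_def openin_C_mod_const)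

text \<open>The second hypothesis says that \<open>W\<close> is saturated, so it is the full
  preimage of its image.\<close>

lemma openin_mod_const_image:
  assumes "openin compact_open W" "\<And>f g c. f \<in> W \<Longrightarrow> g \<in> Cfun \<Longrightarrow> (\<And>x. g x = f x + c) \<Longrightarrow> g \<in> W"
  shows "openin C_mod_const (mod_const ` W)"
proof -
  have W: "W \<subseteq> Cfun"
    using openin_subset[OF assms(1)] by simp
  have "g \<in> W" if "g \<in> Cfun" "f \<in> W" "mod_const g = mod_const f" for f g
    using that W assms(2) mod_const_eq_iff[of g f] by blast
  then have "{f \<in> Cfun. mod_const f \<in> mod_const ` W} = W"
    using W by blast
  then show ?thesis
    using assms(1) W by (auto simp: openin_C_mod_const)
qed

lemma mod_const_mem_imageD:
  assumes "mod_const g \<in> mod_const ` W" "g \<in> Cfun" "W \<subseteq> Cfun"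
    "\<And>f c. f \<in> W \<Longrightarrow> (\<And>x. g x = f x + c) \<Longrightarrow> g \<in> W"
  shows "g \<in> W"
proof -
  obtain f where "f \<in> W" "mod_const g = mod_const f"
    using assms(1) by blast
  then show ?thesis
    using mod_const_eq_iff[of g f] assms(2-4) by blast
qed

text \<open>This is the inverse map of the homeomorphism. Any representative may serve as the
  witness, because differences of values do not depend on it.\<close>

definition class_order :: "('a::metric_space \<Rightarrow> real) set \<Rightarrow> ('a \<times> 'a) set" where
  "class_order c = {(x, y). \<exists>h\<in>c. h x - h y = dist x y}"

lemma class_order_mod_const:
  assumes "f \<in> Cfun"
  shows "class_order (mod_const f) = descent_order f"
proof -
  have "f \<in> mod_const f"
    using assms by (auto simp: mod_const_def intro: exI[of _ 0])
  moreover have "h x - h y = f x - f y" if "h \<in> mod_const f" for h x y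
    using that by (auto simp: mod_const_def)
  ultimately have "(\<exists>h\<in>mod_const f. h x - h y = dist x y) \<longleftrightarrow> f x - f y = dist x y" for x y
    by metis
  then show ?thesis
    by (simp add: class_order_def descent_order_def)
qed

text \<open>A small sphere is a closed subset of a compact neighbourhood. Such spheres will confine
  the roots of nearby orders.\<close>

lemma locally_compact_small_sphere:
  fixes z :: "'a::metric_space"
  assumes "locally compact (UNIV :: 'a set)" "e > 0"
  obtains r where "0 < r" "r \<le> e" "compact (sphere z r)"
proof -
  obtain u v where uv: "openin (top_of_set UNIV) u" "compact v" "z \<in> u" "u \<subseteq> v"
    using assms(1) unfolding locally_def by (metis UNIV_I openin_subtopology_self subset_UNIV)
  then obtain d where d: "d > 0" "cball z d \<subseteq> u"
    by (metis open_contains_cball open_openin subtopology_UNIV)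
  have "sphere z (min d e) \<subseteq> cball z d"
    by auto
  then have "sphere z (min d e) \<subseteq> v"
    using d uv(4) by blast
  have "sphere z (min d e) = cball z (min d e) - ball z (min d e)"
    by auto
  then have "closed (sphere z (min d e))"
    by (metis closed_Diff closed_cball open_ball)
  then have "compact (v \<inter> sphere z (min d e))"
    using uv(2) by (rule compact_Int_closed[rotated])
  then have "compact (sphere z (min d e))"
    using \<open>sphere z (min d e) \<subseteq> v\<close> by (simp add: inf.absorb2)
  then show ?thesis
    using d(1) assms(2) by (intro that[of "min d e"]) auto
qed

context rtree
begin

subsection \<open>The closure of the distance functions\<close>

lemma d_emb_Cfun: "d_emb bp z \<in> Cfun"
  by (simp add: Cfun_def d_emb_def) (intro continuous_intros)

text \<open>Finitely many differences of \<open>h\<close> are approximated by those of a distance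
  function \<open>dist z\<close>. For the latter the meeting point on \<open>[x y]\<close> is the
  median with \<open>z\<close>, and these medians converge to the point that \<open>h\<close>
  prescribes.\<close>

lemma closure_horofunction:
  fixes bp :: 'a
  assumes "h \<in> Cfun" "mod_const h \<in> C_mod_const closure_of range (\<lambda>x. mod_const (d_emb bp x))"
  shows "horofunction h"
proof -
  have approx: "\<exists>z. \<bar>(dist z x - dist z y) - (h x - h y)\<bar> < e \<and> \<bar>(dist z x - dist z j) - (h x - h j)\<bar> < e"
    if e: "e > 0" for x y j :: 'a and e
  proof -
    define W where "W = {f \<in> Cfun. \<bar>f x - f y - (h x - h y)\<bar> < e} \<inter> {f \<in> Cfun. \<bar>f x - f j - (h x - h j)\<bar> < e}"
    have sat: "g \<in> W" if "f \<in> W" "g \<in> Cfun" "\<And>x. g x = f x + c" for f g c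
      using that by (simp add: W_def)
    have "openin compact_open W"
      unfolding W_def by (intro openin_Int openin_compact_open_diff_near)
    then have open_W: "openin C_mod_const (mod_const ` W)"
      by (rule openin_mod_const_image) (rule sat)
    have "h \<in> W"
      using assms(1) e by (simp add: W_def)
    then have "\<exists>c. c \<in> range (\<lambda>x. mod_const (d_emb bp x)) \<and> c \<in> mod_const ` W"
      by (rule assms(2)[unfolded in_closure_of, THEN conjunct2, rule_format, OF conjI, OF imageI open_W])
    then obtain z where z: "mod_const (d_emb bp z) \<in> mod_const ` W"
      by (elim exE conjE rangeE) simp
    have "d_emb bp z \<in> W"
    proof (rule mod_const_mem_imageD[OF z d_emb_Cfun])
      show "W \<subseteq> Cfun"
        unfolding W_def by blast
    qed (rule sat[OF _ d_emb_Cfun])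
    then show ?thesis
      by (intro exI[of _ z]) (simp add: W_def d_emb_def)
  qed
  have lip: "\<bar>h x - h y\<bar> \<le> dist x y" for x y
  proof (rule field_le_epsilon)
    fix e :: real assume "e > 0"
    then obtain z where "\<bar>(dist z x - dist z y) - (h x - h y)\<bar> < e"
      using approx[of e x y y] by blast
    then show "\<bar>h x - h y\<bar> \<le> dist x y + e"
      using dist_triangle[of z x y] dist_triangle[of z y x] dist_commute[of x y] by linarith
  qed
  show ?thesis
    unfolding horofunction_def
  proof (intro allI)
    fix x y
    \<comment> \<open>Subtracting the two slope equations required of \<open>j\<close> leaves this
      value as the only possible distance from \<open>x\<close>.\<close>
    have "0 \<le> (dist x y + h x - h y) / 2" "(dist x y + h x - h y) / 2 \<le> dist x y"
      using lip[of x y] by (auto simp: abs_le_iff)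
    then obtain j where j: "dist x j + dist j y = dist x y" "dist x j = (dist x y + h x - h y) / 2"
      by (rule point_on_segment)
    have "\<bar>h x - h j - dist x j\<bar> \<le> 0 + e" if e: "e > 0" for e
    proof -
      obtain z where z: "\<bar>(dist z x - dist z y) - (h x - h y)\<bar> < e / 2"
          "\<bar>(dist z x - dist z j) - (h x - h j)\<bar> < e / 2"
        using approx[of "e / 2" x y j] e by auto
      obtain m where m: "dist x m + dist m y = dist x y" "dist x m + dist m z = dist x z"
          "dist y m + dist m z = dist y z"
        by (rule median)
      have "2 * dist x m - dist x y = dist z x - dist z y"
        using m dist_commute[of z x] dist_commute[of z y] dist_commute[of y m] by linarith
      moreover have "2 * dist x j - dist x y = h x - h y"
        using j(2) by simp
      ultimately have "\<bar>dist x m - dist x j\<bar> < e / 4"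
        using z(1) by linarith
      moreover have "dist m j = \<bar>dist x m - dist x j\<bar>"
        by (rule dist_on_segment[OF m(1) j(1)])
      ultimately show ?thesis
        using z(2) m(2) dist_triangle[of z j m] dist_triangle[of z m j]
          dist_commute[of z x] dist_commute[of z m] dist_commute[of j m] by linarith
    qed
    then have "\<bar>h x - h j - dist x j\<bar> \<le> 0"
      by (rule field_le_epsilon)
    then have "h x - h j = dist x j"
      by simp
    moreover have "h y - h j = dist y j"
      using calculation j dist_commute[of y j] by (simp add: field_simps)
    ultimately show "\<exists>j. dist x j + dist j y = dist x y \<and> h x - h j = dist x j \<and> h y - h j = dist y j"
      using j(1) by blast
  qed
qed

text \<open>On a compact set \<open>h\<close> equals some \<open>d_emb bp y\<close> up to a
  constant: \<open>y\<close> is the root if there is one, and otherwise a point of the cone of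
  \<open>bp\<close> farther away than the whole set.\<close>

lemma horofunction_closure:
  fixes bp :: 'a
  assumes "horofunction h" "complete (UNIV :: 'a set)"
  shows "mod_const h \<in> C_mod_const closure_of range (\<lambda>x. mod_const (d_emb bp x))"
  unfolding in_closure_of
proof (intro conjI allI impI)
  have h: "h \<in> Cfun"
    using assms(1) by (rule horofunction_Cfun)
  then show "mod_const h \<in> topspace C_mod_const"
    by simp
  fix V assume V: "mod_const h \<in> V \<and> openin C_mod_const V"
  \<comment> \<open>Normalised to vanish at \<open>bp\<close>, as every \<open>d_emb bp y\<close>
    does.\<close>
  define g where "g x = h x - h bp" for x
  have g: "g \<in> Cfun"
    using h unfolding Cfun_def g_def by (auto intro!: continuous_intros)
  have "mod_const g = mod_const h"
    unfolding mod_const_eq_iff[OF g h] g_def by (intro exI[of _ "- h bp"]) simp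
  then have "openin compact_open {f \<in> Cfun. mod_const f \<in> V}" "g \<in> {f \<in> Cfun. mod_const f \<in> V}"
    using V g by (auto simp: openin_C_mod_const)
  then have "\<exists>K. compact K \<and> (\<forall>f\<in>Cfun. (\<forall>x\<in>K. f x = g x) \<longrightarrow> f \<in> {f \<in> Cfun. mod_const f \<in> V})"
    by (rule openin_compact_open_agree_on_compact)
  then obtain K where K: "compact K" "\<And>f. f \<in> Cfun \<Longrightarrow> (\<And>x. x \<in> K \<Longrightarrow> f x = g x) \<Longrightarrow> mod_const f \<in> V"
    by auto
  let ?\<tau> = "descent_order h"
  have \<tau>: "usms ?\<tau>"
    by (rule usms_descent_order[OF assms(1)])
  have "\<exists>y. (bp, y) \<in> ?\<tau> \<and> (\<forall>x\<in>K. (x, y) \<in> ?\<tau>)"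
  proof (cases "?\<tau> \<in> O_plus_r")
    case True
    then show ?thesis
      by (auto simp: O_plus_r_def)
  next
    case False
    obtain R where R: "\<And>x. x \<in> K \<Longrightarrow> dist bp x \<le> R"
      using bounded_any_center[of K bp] compact_imp_bounded[OF K(1)] by blast
    obtain y where y: "(bp, y) \<in> ?\<tau>" "R < dist bp y"
      using unrooted_cone_unbounded[OF \<tau> False assms(2)] by blast
    have "(x, y) \<in> ?\<tau>" if "x \<in> K" for x
      using usms_upper_mem[OF \<tau> y(1), of x] R[OF that] y(2) dist_commute[of x bp] by linarith
    then show ?thesis
      using y(1) by blast
  qed
  then obtain y where y: "h bp - h y = dist bp y" "\<And>x. x \<in> K \<Longrightarrow> h x - h y = dist x y"
    by auto
  have "mod_const (d_emb bp y) \<in> V"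
  proof (rule K(2)[OF d_emb_Cfun])
    fix x assume "x \<in> K"
    then show "d_emb bp y x = g x"
      using y(1) y(2)[of x] dist_commute[of x y] by (simp add: d_emb_def g_def)
  qed
  then show "\<exists>c. c \<in> range (\<lambda>x. mod_const (d_emb bp x)) \<and> c \<in> V"
    by blast
qed

lemma closure_of_range_d_emb:
  fixes bp :: 'a
  assumes "complete (UNIV :: 'a set)"
  shows "C_mod_const closure_of range (\<lambda>x. mod_const (d_emb bp x)) = mod_const ` {h. horofunction h}"
    (is "?C = _")
proof (intro subset_antisym subsetI)
  fix c assume c: "c \<in> ?C"
  then have "c \<in> mod_const ` Cfun"
    using closure_of_subset_topspace[of C_mod_const] by auto
  then obtain h where "h \<in> Cfun" "c = mod_const h"
    by blast
  then show "c \<in> mod_const ` {h. horofunction h}"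
    using c closure_horofunction by blast
next
  fix c :: "('a \<Rightarrow> real) set" assume "c \<in> mod_const ` {h. horofunction h}"
  then obtain h where "horofunction h" "c = mod_const h"
    by blast
  then show "c \<in> ?C"
    using horofunction_closure[OF _ assms] by simp
qed

lemma topspace_metric_compactification:
  fixes bp :: 'a
  assumes "complete (UNIV :: 'a set)"
  shows "topspace (metric_compactification bp) = mod_const ` {h. horofunction h}"
proof -
  have "mod_const ` {h. horofunction h} \<subseteq> (mod_const ` Cfun :: ('a \<Rightarrow> real) set set)"
    using horofunction_Cfun by blast
  then show ?thesis
    unfolding metric_compactification_def closure_of_range_d_emb[OF assms]
    by (simp add: inf.absorb2)
qed


subsection \<open>The homeomorphism\<close>

lemma topspace_O_plus_topology: "topspace (O_plus_topology :: ('a \<times> 'a) set topology) = O_plus"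
proof -
  have "\<Union>base_B \<subseteq> (O_plus :: ('a \<times> 'a) set set)"
    by (auto simp: base_B_def Hd_open_def O_plus_r_def U_set_def)
  then show ?thesis
    by (auto simp: O_plus_topology_def)
qed

lemma openin_O_plus_topology:
  assumes "U \<in> base_B"
  shows "openin O_plus_topology U"
  unfolding O_plus_topology_def using assms by (intro topology_generated_by_Basis) blast

lemma Hd_open_root_order_ball: "Hd_open (root_order ` ball (z::'a) d)"
  unfolding Hd_open_def O_plus_r_eq
proof (intro conjI ballI)
  fix \<tau> assume "\<tau> \<in> root_order ` ball z d"
  then obtain y where y: "\<tau> = root_order y" "dist z y < d" by auto
  have "\<forall>\<sigma>\<in>range root_order. Hd \<tau> \<sigma> < d - dist z y \<longrightarrow> \<sigma> \<in> root_order ` ball z d"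
  proof clarify
    fix x assume "Hd \<tau> (root_order x) < d - dist z y"
    then have "x \<in> ball z d"
      using dist_triangle[of z x y] by (simp add: y(1) Hd_root_order)
    then show "root_order x \<in> root_order ` ball z d"
      by blast
  qed
  then show "\<exists>\<epsilon>>0. \<forall>\<sigma>\<in>range root_order. Hd \<tau> \<sigma> < \<epsilon> \<longrightarrow> \<sigma> \<in> root_order ` ball z d"
    using y(2) by (intro exI[of _ "d - dist z y"]) simp
qed blast

text \<open>Near a rooted order, moving the root changes the cocycle uniformly by at most twice the
  displacement. Near an unrooted one, \<open>y\<close> is chosen above \<open>bp\<close> and all of
  \<open>K\<close>, and every order in \<open>U_set bp y\<close> has the same cocycle on
  \<open>K\<close>.\<close>

lemma continuous_map_cocycle:
  fixes bp :: 'a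
  assumes "complete (UNIV :: 'a set)"
  shows "continuous_map O_plus_topology compact_open (\<lambda>\<tau> x. cocycle \<tau> x bp)"
  unfolding compact_open_def
proof (rule continuous_on_generated_topo)
  have Cfun: "(\<lambda>x. cocycle \<tau> x bp) \<in> Cfun" if "\<tau> \<in> O_plus" for \<tau>
    using that horofunction_Cfun[OF horofunction_cocycle] by (simp add: O_plus_def)
  have "\<Union>{{f \<in> Cfun. f ` K \<subseteq> U} |K U. compact K \<and> open U} = (Cfun :: ('a \<Rightarrow> real) set)"
    using topspace_compact_open unfolding compact_open_def topology_generated_by_topspace .
  then show "(\<lambda>\<tau> x. cocycle \<tau> x bp) ` topspace O_plus_topology
      \<subseteq> \<Union>{{f \<in> Cfun. f ` K \<subseteq> U} |K U. compact K \<and> open U}"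
    using Cfun unfolding topspace_O_plus_topology by (simp add: image_subset_iff)
  fix S :: "('a \<Rightarrow> real) set"
  assume "S \<in> {{f \<in> Cfun. f ` K \<subseteq> U} |K U. compact K \<and> open U}"
  then obtain K U where S: "S = {f \<in> Cfun. f ` K \<subseteq> U}" and K: "compact K" and U: "open U"
    by blast
  have "\<exists>B. openin O_plus_topology B \<and> \<tau> \<in> B \<and> (\<forall>\<sigma>\<in>B. \<forall>x\<in>K. cocycle \<sigma> x bp \<in> U)"
    if \<tau>: "usms \<tau>" and in_U: "\<And>x. x \<in> K \<Longrightarrow> cocycle \<tau> x bp \<in> U" for \<tau>
  proof (cases "\<tau> \<in> O_plus_r")
    case True
    then obtain z where z: "\<tau> = root_order z"
      by (auto simp: O_plus_r_eq)
    have coc: "cocycle (root_order y) x bp = dist y x - dist y bp" for x y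
      by (simp add: root_order_eq cocycle_descent_order horofunction_dist)
    have "compact ((\<lambda>x. cocycle \<tau> x bp) ` K)"
      using Cfun[of \<tau>] \<tau> K unfolding Cfun_def O_plus_def
      by (auto intro: compact_continuous_image continuous_on_subset)
    then obtain d where d: "d > 0" "(\<Union>t\<in>(\<lambda>x. cocycle \<tau> x bp) ` K. ball t d) \<subseteq> U"
      using in_U by (auto intro: compact_subset_open_imp_ball_epsilon_subset[OF _ U])
    have "cocycle (root_order y) x bp \<in> U" if "y \<in> ball z (d / 2)" "x \<in> K" for x y
    proof -
      have "\<bar>cocycle \<tau> x bp - cocycle (root_order y) x bp\<bar> < d"
        using that(1) dist_triangle[of z x y] dist_triangle[of y x z] dist_triangle[of z bp y]
          dist_triangle[of y bp z] dist_commute[of y z]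
        unfolding z coc mem_ball by linarith
      then have "cocycle (root_order y) x bp \<in> ball (cocycle \<tau> x bp) d"
        by (simp add: dist_real_def)
      then show ?thesis
        using d(2) that(2) by blast
    qed
    moreover have "openin O_plus_topology (root_order ` ball z (d / 2))"
      using Hd_open_root_order_ball by (intro openin_O_plus_topology) (simp add: base_B_def)
    moreover have "\<tau> \<in> root_order ` ball z (d / 2)"
      using d(1) z by simp
    ultimately show ?thesis
      by (intro exI[of _ "root_order ` ball z (d / 2)"]) blast
  next
    case False
    obtain R where R: "\<And>x. x \<in> K \<Longrightarrow> dist bp x \<le> R"
      using bounded_any_center[of K bp] compact_imp_bounded[OF K] by blast
    \<comment> \<open>The \<open>0\<close> guarantees \<open>y \<noteq> bp\<close>, as membership of
      \<open>U_set bp y\<close> in the base requires.\<close>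
    obtain y where y: "(bp, y) \<in> \<tau>" "max 0 R < dist bp y"
      using unrooted_cone_unbounded[OF \<tau> False assms] by blast
    have coc: "cocycle \<sigma> x bp = dist x y - dist bp y" if "usms \<sigma>" "(bp, y) \<in> \<sigma>" "x \<in> K" for \<sigma> x
    proof (rule cocycle_upper_bound[OF that(1) _ that(2)])
      show "(x, y) \<in> \<sigma>"
        using usms_upper_mem[OF that(1,2), of x] R[OF that(3)] y(2) dist_commute[of x bp] by linarith
    qed
    have "openin O_plus_topology (U_set bp y)"
      using y(2) by (intro openin_O_plus_topology) (auto simp: base_B_def)
    moreover have "\<tau> \<in> U_set bp y"
      using False \<tau> y(1) by (auto simp: U_set_def O_plus_def O_plus_r_eq)
    moreover have "cocycle \<sigma> x bp \<in> U" if "\<sigma> \<in> U_set bp y" "x \<in> K" for \<sigma> x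
      using that in_U[of x] coc[of \<sigma> x] coc[of \<tau> x] \<tau> y(1) by (simp add: U_set_def O_plus_def)
    ultimately show ?thesis
      by blast
  qed
  then have nbhd: "\<exists>B. openin O_plus_topology B \<and> \<tau> \<in> B \<and> (\<forall>\<sigma>\<in>B. \<forall>x\<in>K. cocycle \<sigma> x bp \<in> U)"
    if "\<tau> \<in> (\<lambda>\<tau> x. cocycle \<tau> x bp) -` S \<inter> O_plus" for \<tau>
    using that by (auto simp: S O_plus_def)
  show "openin O_plus_topology ((\<lambda>\<tau> x. cocycle \<tau> x bp) -` S \<inter> topspace O_plus_topology)"
    unfolding topspace_O_plus_topology
  proof (subst openin_subopen, intro ballI)
    fix \<tau> assume "\<tau> \<in> (\<lambda>\<tau> x. cocycle \<tau> x bp) -` S \<inter> O_plus"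
    then obtain B where B: "openin O_plus_topology B" "\<tau> \<in> B" "\<forall>\<sigma>\<in>B. \<forall>x\<in>K. cocycle \<sigma> x bp \<in> U"
      using nbhd by blast
    then have "B \<subseteq> O_plus"
      using openin_subset topspace_O_plus_topology by blast
    then have "B \<subseteq> (\<lambda>\<tau> x. cocycle \<tau> x bp) -` S \<inter> O_plus"
      using B(3) Cfun by (auto simp: S)
    then show "\<exists>B. openin O_plus_topology B \<and> \<tau> \<in> B \<and> B \<subseteq> (\<lambda>\<tau> x. cocycle \<tau> x bp) -` S \<inter> O_plus"
      using B by blast
  qed
qed

text \<open>If \<open>y\<close> is not the root, some \<open>y'\<close> lies strictly above it, and the strict inequality
  \<open>f y - f y' > - dist y y'\<close> alone forces \<open>x\<close> below \<open>y\<close>.\<close>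

lemma descent_order_U_set:
  assumes "horofunction g" "dist x y + dist y y' = dist x y'" "g y - g y' > - dist y (y'::'a)"
  shows "descent_order g \<in> U_set x y"
proof -
  obtain j where j: "dist y j + dist j y' = dist y y'" "g y - g j = dist y j" "g y' - g j = dist y' j"
    using assms(1) by (rule horofunctionE)
  obtain k where k: "dist x k + dist k y = dist x y" "g x - g k = dist x k" "g y - g k = dist y k"
    using assms(1) by (rule horofunctionE)
  \<comment> \<open>With \<open>j = y\<close> the function would rise with unit slope from
    \<open>y\<close> to \<open>y'\<close>, against the strict inequality.\<close>
  have pos: "dist y j > 0"
    using assms(3) j dist_commute[of y' j] by linarith
  \<comment> \<open>The points \<open>k\<close>, \<open>y\<close>, \<open>j\<close> follow one
    another on \<open>[x y']\<close>. Both \<open>k\<close> and \<open>j\<close> lie above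
    \<open>y\<close>, hence are comparable, and on opposite sides of \<open>y\<close> this is
    possible only if \<open>k = y\<close>.\<close>
  have "dist k j = dist k y + dist y j"
    using assms(2) j(1) k(1) dist_triangle[of x y' k] dist_triangle[of k y' j] dist_triangle[of k j y]
    by linarith
  then have "dist k y = 0"
    using descent_order_linear[OF assms(1) j(2) k(3)] j(2) k(3) pos dist_commute[of y k]
      dist_commute[of j k] zero_le_dist[of k y] by linarith
  then have "(x, y) \<in> descent_order g"
    using k(2) by simp
  moreover have "descent_order g \<noteq> root_order y"
  proof
    assume "descent_order g = root_order y"
    then have "(j, y) \<in> descent_order g"
      using root_order_root by simp
    then show False
      using j(2) pos dist_commute[of j y] by simp
  qed
  ultimately show ?thesis
    using usms_descent_order[OF assms(1)] by (simp add: U_set_def O_plus_def)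
qed

text \<open>With the root outside the ball, the descending ray from \<open>z\<close> would cross the sphere.\<close>

lemma root_in_ball:
  assumes "horofunction g" "complete (UNIV :: 'a set)" "\<And>x. x \<in> sphere z r \<Longrightarrow> g z < g x" "r > 0"
  obtains y :: 'a where "descent_order g = root_order y" "dist z y < r"
proof -
  have \<tau>: "usms (descent_order g)"
    by (rule usms_descent_order[OF assms(1)])
  have bound: "dist z y < r" if "(z, y) \<in> descent_order g" for y
  proof (rule ccontr)
    assume "\<not> dist z y < r"
    then obtain x where x: "dist z x + dist x y = dist z y" "dist z x = r"
      using assms(4) by (auto intro: point_on_segment[of r z y])
    then have "g z < g x"
      using assms(3) by simp
    then show False
      using that x assms(4) horofunction_diff_le[OF assms(1), of x y] by simp
  qed
  then have "descent_order g \<in> O_plus_r"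
    using unrooted_cone_unbounded[OF \<tau> _ assms(2), of z r] by force
  then obtain y where "descent_order g = root_order y"
    by (auto simp: O_plus_r_eq)
  then show ?thesis
    using that bound root_order_root by metis
qed

text \<open>Each basic open set is handled by a saturated neighbourhood of a representative
  \<open>h\<close>, given by strict inequalities: on a small sphere around the root for
  \<open>Hd\<close>-open sets, between two points for the sets \<open>U_set x y\<close>.\<close>

lemma continuous_map_class_order:
  fixes bp :: 'a
  assumes complete: "complete (UNIV :: 'a set)" and loc: "locally compact (UNIV :: 'a set)"
  shows "continuous_map (metric_compactification bp) O_plus_topology class_order"
  unfolding O_plus_topology_def
proof (rule continuous_on_generated_topo)
  let ?M = "metric_compactification bp"
  have topM: "topspace ?M = mod_const ` {h. horofunction h}"
    by (rule topspace_metric_compactification[OF complete])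
  have co: "class_order (mod_const h) = descent_order h" if "horofunction h" for h :: "'a \<Rightarrow> real"
    using that by (intro class_order_mod_const horofunction_Cfun)
  have in_O_plus: "class_order c \<in> O_plus" if "c \<in> topspace ?M" for c
    using that co usms_descent_order unfolding topM O_plus_def by force
  then show "class_order ` topspace ?M \<subseteq> \<Union>(insert O_plus base_B)"
    by blast
  have openI: "openin ?M (class_order -` U \<inter> topspace ?M)"
    if *: "\<And>h. horofunction h \<Longrightarrow> descent_order h \<in> U \<Longrightarrow>
      \<exists>W. openin compact_open W \<and> h \<in> W \<and>
        (\<forall>f\<in>W. \<forall>g\<in>Cfun. \<forall>c. (\<forall>x. g x = f x + c) \<longrightarrow> g \<in> W) \<and>
        (\<forall>g\<in>W. horofunction g \<longrightarrow> descent_order g \<in> U)" for U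
  proof (subst openin_subopen, intro ballI)
    fix c assume c: "c \<in> class_order -` U \<inter> topspace ?M"
    then obtain h where h: "horofunction h" "c = mod_const h"
      unfolding topM by blast
    then obtain W where W: "openin compact_open W" "h \<in> W"
      "\<And>f g c. f \<in> W \<Longrightarrow> g \<in> Cfun \<Longrightarrow> (\<And>x. g x = f x + c) \<Longrightarrow> g \<in> W"
      "\<And>g. g \<in> W \<Longrightarrow> horofunction g \<Longrightarrow> descent_order g \<in> U"
      using *[OF h(1)] c co[OF h(1)] by auto
    have "openin C_mod_const (mod_const ` W)"
      by (rule openin_mod_const_image[OF W(1,3)])
    then have "openin ?M (topspace ?M \<inter> mod_const ` W)"
      unfolding metric_compactification_def by (auto simp: openin_subtopology)
    moreover have "c \<in> topspace ?M \<inter> mod_const ` W"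
      using c h W(2) by blast
    moreover have "topspace ?M \<inter> mod_const ` W \<subseteq> class_order -` U \<inter> topspace ?M"
    proof
      fix d assume d: "d \<in> topspace ?M \<inter> mod_const ` W"
      then obtain g where g: "horofunction g" "d = mod_const g"
        unfolding topM by blast
      have "g \<in> W"
      proof (rule mod_const_mem_imageD)
        show "mod_const g \<in> mod_const ` W"
          using d g(2) by blast
        show "W \<subseteq> Cfun"
          using openin_subset[OF W(1)] by simp
      qed (rule horofunction_Cfun[OF g(1)], rule W(3)[OF _ horofunction_Cfun[OF g(1)]])
      then show "d \<in> class_order -` U \<inter> topspace ?M"
        using d g(2) W(4)[OF _ g(1)] co[OF g(1)] by simp
    qed
    ultimately show "\<exists>T. openin ?M T \<and> c \<in> T \<and> T \<subseteq> class_order -` U \<inter> topspace ?M"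
      by blast
  qed
  fix U :: "('a \<times> 'a) set set"
  assume "U \<in> insert O_plus base_B"
  then consider "U = O_plus" | "Hd_open U" | x y where "U = U_set x y"
    by (auto simp: base_B_def)
  then show "openin ?M (class_order -` U \<inter> topspace ?M)"
  proof cases
    case 1
    then have "class_order -` U \<inter> topspace ?M = topspace ?M"
      using in_O_plus by blast
    then show ?thesis
      by simp
  next
    case 2
    show ?thesis
    proof (rule openI)
      fix h :: "'a \<Rightarrow> real" assume h: "horofunction h" "descent_order h \<in> U"
      then obtain z where z: "descent_order h = root_order z"
        using 2 by (auto simp: Hd_open_def O_plus_r_eq)
      obtain e where e: "e > 0" "\<And>y. dist z y < e \<Longrightarrow> root_order y \<in> U"
        using 2 h(2) by (force simp: Hd_open_def O_plus_r_eq z Hd_root_order)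
      obtain r where r: "0 < r" "r \<le> e" "compact (sphere z r)"
        using locally_compact_small_sphere[OF loc e(1)] .
      \<comment> \<open>At its root \<open>z\<close> the function \<open>h\<close> is lower by
        exactly \<open>r\<close> than on the sphere; a horofunction that keeps the strict inequality
        has its root inside the ball.\<close>
      let ?W = "{f \<in> Cfun. \<forall>x\<in>sphere z r. f z < f x}"
      have "h z < h x" if "x \<in> sphere z r" for x
      proof -
        have "(x, z) \<in> descent_order h"
          unfolding z by (rule root_order_root)
        then show ?thesis
          using that r(1) dist_commute[of x z] by simp
      qed
      then have "h \<in> ?W"
        using horofunction_Cfun[OF h(1)] by simp
      moreover have "descent_order g \<in> U" if g: "g \<in> ?W" "horofunction g" for g
      proof -
        obtain y where "descent_order g = root_order y" "dist z y < r"
          using root_in_ball[OF g(2) complete _ r(1), of z] g(1) by blast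
        then show ?thesis
          using e(2) r(2) by simp
      qed
      ultimately show "\<exists>W. openin compact_open W \<and> h \<in> W \<and>
        (\<forall>f\<in>W. \<forall>g\<in>Cfun. \<forall>c. (\<forall>x. g x = f x + c) \<longrightarrow> g \<in> W) \<and>
        (\<forall>g\<in>W. horofunction g \<longrightarrow> descent_order g \<in> U)"
        using openin_compact_open_less_on_compact[OF r(3), of z] by (intro exI[of _ ?W]) auto
    qed
  next
    case (3 x y)
    show ?thesis
    proof (rule openI)
      fix h :: "'a \<Rightarrow> real" assume h: "horofunction h" "descent_order h \<in> U"
      have \<tau>: "usms (descent_order h)"
        by (rule usms_descent_order[OF h(1)])
      have xy: "(x, y) \<in> descent_order h" "descent_order h \<noteq> root_order y"
        using h(2) 3 by (auto simp: U_set_def)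
      \<comment> \<open>As the order is not the one rooted at \<open>y\<close>, the point
        \<open>y\<close> is not greatest, hence not maximal.\<close>
      obtain y' where y': "(y, y') \<in> descent_order h" "y' \<noteq> y"
        using xy(2) maximal_imp_greatest[OF \<tau>, of y] rooted_eq_root_order[OF \<tau>] by blast
      have btw: "dist x y + dist y y' = dist x y'"
        using usms_dist_add[OF \<tau> xy(1) y'(1)] .
      let ?W = "{f \<in> Cfun. f y - f y' > - dist y y'}"
      have "h y - h y' > - dist y y'"
        using y' zero_less_dist_iff[of y y'] by auto
      then have "h \<in> ?W"
        using horofunction_Cfun[OF h(1)] by simp
      moreover have "descent_order g \<in> U" if "g \<in> ?W" "horofunction g" for g
        using descent_order_U_set[OF that(2) btw] that(1) 3 by simp
      ultimately show "\<exists>W. openin compact_open W \<and> h \<in> W \<and>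
        (\<forall>f\<in>W. \<forall>g\<in>Cfun. \<forall>c. (\<forall>x. g x = f x + c) \<longrightarrow> g \<in> W) \<and>
        (\<forall>g\<in>W. horofunction g \<longrightarrow> descent_order g \<in> U)"
        using openin_compact_open_diff_gt by (intro exI[of _ ?W]) auto
    qed
  qed
qed

lemma homeomorphic_O_plus_metric_compactification:
  fixes bp :: 'a
  assumes "complete (UNIV :: 'a set)" "locally compact (UNIV :: 'a set)"
  shows "(O_plus_topology :: ('a \<times> 'a) set topology) homeomorphic_space metric_compactification bp"
proof -
  let ?\<Phi> = "\<lambda>\<tau>. mod_const (\<lambda>x. cocycle \<tau> x bp)"
  have "continuous_map O_plus_topology C_mod_const (mod_const \<circ> (\<lambda>\<tau> x. cocycle \<tau> x bp))"
    by (rule continuous_map_compose[OF continuous_map_cocycle[OF assms(1)] continuous_map_mod_const])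
  moreover have "?\<Phi> ` O_plus \<subseteq> mod_const ` {h. horofunction h}"
    using horofunction_cocycle by (auto simp: O_plus_def)
  then have "?\<Phi> ` O_plus \<subseteq> C_mod_const closure_of range (\<lambda>x. mod_const (d_emb bp x))"
    unfolding closure_of_range_d_emb[OF assms(1)] .
  ultimately have "continuous_map O_plus_topology (metric_compactification bp) ?\<Phi>"
    by (auto simp: metric_compactification_def continuous_map_in_subtopology
        topspace_O_plus_topology comp_def)
  moreover have "class_order (?\<Phi> \<tau>) = \<tau>" if "\<tau> \<in> O_plus" for \<tau>
    using that class_order_mod_const[OF horofunction_Cfun[OF horofunction_cocycle[of \<tau> bp]]]
      descent_order_cocycle[of \<tau> bp] by (simp add: O_plus_def)
  moreover have "?\<Phi> (class_order c) = c" if c: "c \<in> topspace (metric_compactification bp)" for c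
  proof -
    obtain h where h: "horofunction h" "c = mod_const h"
      using c topspace_metric_compactification[OF assms(1)] by blast
    have co: "class_order c = descent_order h"
      using h by (simp add: class_order_mod_const horofunction_Cfun)
    have "mod_const (\<lambda>x. cocycle (descent_order h) x bp) = mod_const h"
      using horofunction_Cfun[OF horofunction_cocycle[OF usms_descent_order[OF h(1)]]]
      by (subst mod_const_eq_iff)
        (auto simp: horofunction_Cfun h(1) cocycle_descent_order intro: exI[of _ "- h bp"])
    then show ?thesis
      unfolding co using h(2) by simp
  qed
  ultimately have "homeomorphic_maps O_plus_topology (metric_compactification bp) ?\<Phi> class_order"
    using continuous_map_class_order[OF assms]
    by (simp add: homeomorphic_maps_def topspace_O_plus_topology)
  then show ?thesis
    by (rule homeomorphic_maps_imp_homeomorphic_space)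
qed

lemma O_plus_r_isometric:
  "\<exists>f. bij_betw f (O_plus_r :: ('a \<times> 'a) set set) (UNIV :: 'a set) \<and> (\<forall>\<tau>\<in>O_plus_r. \<forall>\<sigma>\<in>O_plus_r. Hd \<tau> \<sigma> = dist (f \<tau>) (f \<sigma>))"
proof (intro exI[of _ "inv root_order"] conjI)
  show "bij_betw (inv root_order) O_plus_r (UNIV :: 'a set)"
    unfolding O_plus_r_eq by (rule inj_imp_bij_betw_inv[OF inj_root_order])
  show "\<forall>\<tau>\<in>O_plus_r. \<forall>\<sigma>\<in>O_plus_r. Hd \<tau> \<sigma> = dist (inv root_order \<tau> :: 'a) (inv root_order \<sigma>)"
    by (auto simp: O_plus_r_eq inv_f_f[OF inj_root_order] Hd_root_order)
qed

end

theorem theorem2: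
  fixes bp :: "'a::metric_space"
  assumes "R_tree TYPE('a)"
    and "complete (UNIV :: 'a set)"
    and "locally compact (UNIV :: 'a set)"
  shows "(\<exists>f. bij_betw f (O_plus_r :: ('a \<times> 'a) set set) (UNIV :: 'a set) \<and>
            (\<forall>\<tau>\<in>O_plus_r. \<forall>\<sigma>\<in>O_plus_r. Hd \<tau> \<sigma> = dist (f \<tau>) (f \<sigma>)))
       \<and> (O_plus_topology :: ('a \<times> 'a) set topology) homeomorphic_space
           metric_compactification bp"
proof -
  interpret rtree "TYPE('a)"
    by standard (rule assms(1))
  show ?thesis
    using O_plus_r_isometric homeomorphic_O_plus_metric_compactification[OF assms(2,3)] by blast
qed

end
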